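(* For each $k=0,1,2$, $c_k$ defines a non-trivial (real valued) 2-cocycle on the algebra $S^3\mathbf{H}$. That is, for all $\phi_1,\phi_2,\phi_3\in S^3\mathbf{H}$, $$c_k(\phi_1,\phi_2)=-c_k(\phi_2,\phi_1),$$ $$c_k(\phi_1\cdot\phi_2,\phi_3)+c_k(\phi_2\cdot\phi_3,\phi_1)+c_k(\phi_3\cdot\phi_1,\phi_2)=0,$$ and there is no 1-cochain $b$ such that $c_k(\phi_1,\phi_2)=b([\phi_1,\phi_2])$ for all $\phi_1,\phi_2\in S^3\mathbf{H}$.
   Context: Quaternions are written $x=z_1+jz_2$ with $z_1,z_2\in\mathbf{C}$, $zj=j\bar z$; $\mathbf{C}$ acts on $\mathbf{H}$ from the right, so $\mathbf{H}\simeq\mathbf{C}^2$ as $\mathbf{C}$-vector spaces, $z_1+jz_2\leftrightarrow\begin{pmatrix}z_1\\ z_2\end{pmatrix}$. Let $S^3=\{|z|=1\}\subset\mathbf{C}^2$ and $S^3\mathbf{H}=C^\infty(S^3,\mathbf{H})$. Elements of $S^3\mathbf{H}$ (even spinors on $S^3$) are written $u+jv=\begin{pmatrix}u\\ v\end{pmatrix}$ with $u,v$ smooth complex functions on $S^3$. The product is the pointwise quaternion product $$\begin{pmatrix}u_1\\ v_1\end{pmatrix}\cdot\begin{pmatrix}u_2\\ v_2\end{pmatrix}=\begin{pmatrix}u_1u_2-\bar v_1v_2\\ v_1u_2+\bar u_1v_2\end{pmatrix},$$ and $[\phi_1,\phi_2]=\phi_1\cdot\phi_2-\phi_2\cdot\phi_1$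 (an $\mathbf{R}$-bilinear bracket). The trace is $\mathrm{tr}\begin{pmatrix}u\\ v\end{pmatrix}=u+\bar u$. Vector fields on $S^3$ (with the standard Wirtinger derivatives): $$e_+=-z_2\frac{\partial}{\partial\bar z_1}+z_1\frac{\partial}{\partial\bar z_2},\quad e_-=-\bar z_2\frac{\partial}{\partial z_1}+\bar z_1\frac{\partial}{\partial z_2},\quad \theta=z_1\frac{\partial}{\partial z_1}+z_2\frac{\partial}{\partial z_2}-\bar z_1\frac{\partial}{\partial\bar z_1}-\bar z_2\frac{\partial}{\partial\bar z_2},$$ $$\theta_0=\sqrt{-1}\,\theta,\quad\theta_1=e_++e_-,\quad\theta_2=\sqrt{-1}(e_+-e_-).$$ These $\theta_k$ are real vector fields tangent to $S^3$. Put $\Theta_k\begin{pmatrix}u\\ v\end{pmatrix}=\frac12\begin{pmatrix}\theta_ku\\ \theta_kv\end{pmatrix}$ and $$c_k(\phi_1,\phi_2)=\frac1{2\pi^2}\int_{S^3}\mathrm{tr}\big((\Theta_k\phi_1)\cdot\phi_2\big)\,d\sigma,\qquad k=0,1,2,$$ where $d\sigma$ is the standard volume form on $S^3$ (total volume $2\pi^2$). A 1-cochain is an $\mathbf{R}$-linear map $b:S^3\mathbf{H}\to\mathbf{C}$. *)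

theory Defs
  imports "HOL-Analysis.Analysis"
begin

section \<open>Quaternions as pairs of complex numbers\<close>

text \<open>
  The pair \<open>(z1, z2)\<close> stands for the quaternion \<open>z1 + j z2\<close>, where \<open>z j = j (cnj z)\<close>.
  Addition, real scaling and the Euclidean norm are those of the product type
  \<^typ>\<open>complex \<times> complex\<close>; the multiplication is
  \<open>(u1 + j v1)(u2 + j v2) = (u1 u2 - cnj v1 v2) + j (v1 u2 + cnj u1 v2)\<close>.
\<close>

definition qmult :: "complex \<times> complex \<Rightarrow> complex \<times> complex \<Rightarrow> complex \<times> complex" where
  "qmult x y = (fst x * fst y - cnj (snd x) * snd y, snd x * fst y + cnj (fst x) * snd y)"

text \<open>The values of the trace are real, but they are kept in \<^typ>\<open>complex\<close>, because cochains
  take complex values.\<close>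

definition qtr :: "complex \<times> complex \<Rightarrow> complex" where
  "qtr x = fst x + cnj (fst x)"


section \<open>The sphere and its volume measure\<close>

typedef s3 = "sphere (0 :: complex \<times> complex) 1"
  by (rule exI[of _ "(1, 0)"]) simp

definition radial_proj :: "complex \<times> complex \<Rightarrow> s3" where
  "radial_proj x = Abs_s3 (sgn x)"

lemma norm_Rep_s3 [simp]: "norm (Rep_s3 p) = 1"
  using Rep_s3[of p] by simp

lemma Rep_radial_proj: "x \<noteq> 0 \<Longrightarrow> Rep_s3 (radial_proj x) = sgn x"
  unfolding radial_proj_def by (rule Abs_s3_inverse) (simp add: norm_sgn)

lemma radial_proj_Rep [simp]: "radial_proj (Rep_s3 p) = p"
  by (simp add: radial_proj_def sgn_div_norm Rep_s3_inverse)

text \<open>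
  In polar coordinates Lebesgue measure on \<open>\<real>\<^sup>4\<close> is \<open>r\<^sup>3 dr d\<sigma>\<close>.  Accordingly the standard volume
  measure assigns to a Borel set \<open>A \<subseteq> S\<^sup>3\<close> four times the Lebesgue measure of the cone
  \<open>{r x | x \<in> A, 0 < r < 1}\<close>.
\<close>

definition sigma3 :: "s3 measure" where
  "sigma3 = scale_measure 4
     (distr (restrict_space lborel (ball 0 1 - {0})) (vimage_algebra UNIV Rep_s3 borel) radial_proj)"

lemma measurable_radial_proj:
  "radial_proj \<in> restrict_space lborel (ball 0 1 - {0}) \<rightarrow>\<^sub>M vimage_algebra UNIV Rep_s3 borel"
proof (rule measurable_vimage_algebra2)
  have "(sgn :: complex \<times> complex \<Rightarrow> _) \<in> borel_measurable borel"
    unfolding sgn_div_norm[abs_def] by measurable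
  hence "(sgn :: complex \<times> complex \<Rightarrow> _) \<in> borel_measurable (restrict_space lborel (ball 0 1 - {0}))"
    by (simp add: measurable_restrict_space1)
  thus "(\<lambda>x. Rep_s3 (radial_proj x)) \<in> borel_measurable (restrict_space lborel (ball 0 1 - {0}))"
    by (rule measurable_cong[THEN iffD2, rotated])
       (auto simp: space_restrict_space Rep_radial_proj)
qed simp

lemma space_sigma3 [simp]: "space sigma3 = UNIV"
  by (simp add: sigma3_def space_scale_measure)

lemma emeasure_sigma3:
  assumes "A \<in> sets sigma3"
  shows "emeasure sigma3 A = 4 * emeasure lborel {x \<in> ball 0 1 - {0}. radial_proj x \<in> A}"
proof -
  have A: "A \<in> sets (vimage_algebra UNIV Rep_s3 borel)"
    using assms by (simp add: sigma3_def)
  have "emeasure (restrict_space lborel (ball 0 1 - {0}))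
          (radial_proj -` A \<inter> space (restrict_space lborel (ball 0 1 - {0})))
      = emeasure lborel {x \<in> ball 0 1 - {0}. radial_proj x \<in> A}"
    by (subst emeasure_restrict_space)
       (auto simp: space_restrict_space intro!: arg_cong[where f = "emeasure lborel"])
  thus ?thesis
    by (simp add: sigma3_def emeasure_distr[OF measurable_radial_proj A])
qed

lemma measure_sigma3_UNIV: "measure sigma3 UNIV = 2 * pi\<^sup>2"
proof -
  have "emeasure lborel (ball (0 :: complex \<times> complex) 1 - {0}) = emeasure lborel (ball (0 :: complex \<times> complex) 1)"
    by (rule emeasure_Diff_null_set) auto
  also have "\<dots> = ennreal (pi\<^sup>2 / 2)"
    by (simp add: emeasure_ball unit_ball_vol_4)
  finally have "emeasure sigma3 UNIV = 4 * ennreal (pi\<^sup>2 / 2)"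
    using emeasure_sigma3[of UNIV] sets.top[of sigma3] by (simp add: set_diff_eq)
  also have "\<dots> = ennreal (4 * (pi\<^sup>2 / 2))"
    by (subst ennreal_mult) auto
  finally have "emeasure sigma3 UNIV = ennreal (2 * pi\<^sup>2)"
    by simp
  thus ?thesis
    by (simp add: measure_def)
qed


section \<open>Smooth functions on the sphere\<close>

text \<open>Being of class \<open>C\<^sup>n\<close> on an open set \<open>U\<close>.\<close>

primrec C_diff_on :: "nat \<Rightarrow> 'a::euclidean_space set \<Rightarrow> ('a \<Rightarrow> 'b::real_normed_vector) \<Rightarrow> bool" where
  "C_diff_on 0 U f \<longleftrightarrow> continuous_on U f"
| "C_diff_on (Suc n) U f \<longleftrightarrow> (\<forall>x\<in>U. f differentiable (at x)) \<and>
     (\<forall>v. C_diff_on n U (\<lambda>x. frechet_derivative f (at x) v))"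

text \<open>A function on \<open>S\<^sup>3\<close> is smooth iff it is the restriction of a smooth function on a
  neighbourhood of \<open>S\<^sup>3\<close> in \<open>\<complex>\<^sup>2\<close>.\<close>

definition smooth_s3 :: "(s3 \<Rightarrow> complex) \<Rightarrow> bool" where
  "smooth_s3 f \<longleftrightarrow> (\<exists>U F. open U \<and> sphere 0 1 \<subseteq> U \<and> (\<forall>n. C_diff_on n U F) \<and>
     (\<forall>p. F (Rep_s3 p) = f p))"


section \<open>The vector fields\<close>

definition d_z1 :: "(complex \<times> complex \<Rightarrow> complex) \<Rightarrow> complex \<times> complex \<Rightarrow> complex" where
  "d_z1 F x = (frechet_derivative F (at x) (1, 0) - \<i> * frechet_derivative F (at x) (\<i>, 0)) / 2"

definition d_z2 :: "(complex \<times> complex \<Rightarrow> complex) \<Rightarrow> complex \<times> complex \<Rightarrow> complex" where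
  "d_z2 F x = (frechet_derivative F (at x) (0, 1) - \<i> * frechet_derivative F (at x) (0, \<i>)) / 2"

definition d_zbar1 :: "(complex \<times> complex \<Rightarrow> complex) \<Rightarrow> complex \<times> complex \<Rightarrow> complex" where
  "d_zbar1 F x = (frechet_derivative F (at x) (1, 0) + \<i> * frechet_derivative F (at x) (\<i>, 0)) / 2"

definition d_zbar2 :: "(complex \<times> complex \<Rightarrow> complex) \<Rightarrow> complex \<times> complex \<Rightarrow> complex" where
  "d_zbar2 F x = (frechet_derivative F (at x) (0, 1) + \<i> * frechet_derivative F (at x) (0, \<i>)) / 2"

definition e_plus :: "(complex \<times> complex \<Rightarrow> complex) \<Rightarrow> complex \<times> complex \<Rightarrow> complex" where
  "e_plus F = (\<lambda>(z1, z2). - z2 * d_zbar1 F (z1, z2) + z1 * d_zbar2 F (z1, z2))"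

definition e_minus :: "(complex \<times> complex \<Rightarrow> complex) \<Rightarrow> complex \<times> complex \<Rightarrow> complex" where
  "e_minus F = (\<lambda>(z1, z2). - cnj z2 * d_z1 F (z1, z2) + cnj z1 * d_z2 F (z1, z2))"

definition theta :: "(complex \<times> complex \<Rightarrow> complex) \<Rightarrow> complex \<times> complex \<Rightarrow> complex" where
  "theta F = (\<lambda>(z1, z2). z1 * d_z1 F (z1, z2) + z2 * d_z2 F (z1, z2)
                 - cnj z1 * d_zbar1 F (z1, z2) - cnj z2 * d_zbar2 F (z1, z2))"

text \<open>Only the indices 0, 1 and 2 are meaningful.\<close>

definition theta_amb :: "nat \<Rightarrow> (complex \<times> complex \<Rightarrow> complex) \<Rightarrow> complex \<times> complex \<Rightarrow> complex" where
  "theta_amb k F x =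
     (if k = 0 then \<i> * theta F x
      else if k = 1 then e_plus F x + e_minus F x
      else \<i> * (e_plus F x - e_minus F x))"

text \<open>
  A function on \<open>S\<^sup>3\<close> is differentiated via its extension to \<open>\<complex>\<^sup>2 - {0}\<close> that is constant along rays.
  As the fields are tangent to \<open>S\<^sup>3\<close>, any other extension gives the same result:
  see \<open>theta_s3_extension\<close> below.
\<close>

definition theta_s3 :: "nat \<Rightarrow> (s3 \<Rightarrow> complex) \<Rightarrow> s3 \<Rightarrow> complex" where
  "theta_s3 k f p = theta_amb k (\<lambda>x. f (radial_proj x)) (Rep_s3 p)"

definition theta_vec :: "nat \<Rightarrow> complex \<times> complex \<Rightarrow> complex \<times> complex" where
  "theta_vec k = (\<lambda>(z1, z2).
     (if k = 0 then (\<i> * z1, \<i> * z2)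
      else if k = 1 then (- cnj z2, cnj z1)
      else (\<i> * cnj z2, - \<i> * cnj z1)))"

lemma theta_vec_tangent: "x \<bullet> theta_vec k x = 0"
  by (cases x) (simp add: theta_vec_def inner_complex_def)

lemma theta_amb_eq_frechet_derivative:
  assumes "F differentiable (at x)"
  shows "theta_amb k F x = frechet_derivative F (at x) (theta_vec k x)"
proof -
  let ?D = "frechet_derivative F (at x)"
  interpret D: linear ?D
    using assms by (rule linear_frechet_derivative)
  have D: "?D (a, b) = of_real (Re a) * ?D (1, 0) + of_real (Im a) * ?D (\<i>, 0)
                     + of_real (Re b) * ?D (0, 1) + of_real (Im b) * ?D (0, \<i>)" for a b
  proof -
    have "(a, b) = Re a *\<^sub>R (1, 0) + Im a *\<^sub>R (\<i>, 0) + Re b *\<^sub>R (0, 1) + Im b *\<^sub>R (0, \<i>)"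
      by (simp add: complex_eq_iff)
    hence "?D (a, b) = ?D (Re a *\<^sub>R (1, 0) + Im a *\<^sub>R (\<i>, 0) + Re b *\<^sub>R (0, 1) + Im b *\<^sub>R (0, \<i>))"
      by (rule arg_cong)
    also have "\<dots> = of_real (Re a) * ?D (1, 0) + of_real (Im a) * ?D (\<i>, 0)
                     + of_real (Re b) * ?D (0, 1) + of_real (Im b) * ?D (0, \<i>)"
      by (simp only: D.add D.scaleR scaleR_conv_of_real)
    finally show ?thesis .
  qed
  obtain z1 z2 where x: "x = (z1, z2)"
    by (cases x)
  define A B C E where "A = ?D (1, 0)" and "B = ?D (\<i>, 0)" and "C = ?D (0, 1)" and "E = ?D (0, \<i>)"
  have "?D (theta_vec k x) =
      of_real (Re (fst (theta_vec k x))) * A + of_real (Im (fst (theta_vec k x))) * B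
    + of_real (Re (snd (theta_vec k x))) * C + of_real (Im (snd (theta_vec k x))) * E"
    using D[of "fst (theta_vec k x)" "snd (theta_vec k x)"] by (simp add: A_def B_def C_def E_def)
  moreover have "theta_amb k F x = \<dots>"
    unfolding theta_amb_def theta_def e_plus_def e_minus_def d_z1_def d_z2_def d_zbar1_def d_zbar2_def
      x prod.case A_def[unfolded x, symmetric] B_def[unfolded x, symmetric]
      C_def[unfolded x, symmetric] E_def[unfolded x, symmetric]
    by (simp add: theta_vec_def complex_eq_iff) (simp add: field_simps)
  ultimately show ?thesis
    by simp
qed

lemma theta_s3_extension:
  assumes F: "F differentiable (at (Rep_s3 p))" and agree: "\<And>q. F (Rep_s3 q) = f q"
  shows "theta_s3 k f p = theta_amb k F (Rep_s3 p)"
proof -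
  define x where "x = Rep_s3 p"
  have norm_x: "norm x = 1"
    by (simp add: x_def)
  hence nx: "norm x = 1" "x \<noteq> 0"
    by auto
  have sgn_x: "sgn x = x"
    using nx by (simp add: sgn_div_norm)
  have "((\<lambda>y. inverse (norm y)) has_derivative (\<lambda>h. - (x \<bullet> h))) (at x)"
    using Deriv.has_derivative_inverse[OF _ has_derivative_norm[OF nx(2)]] nx
    by (simp add: sgn_x inner_commute)
  from has_derivative_scaleR[OF this has_derivative_ident]
  have "((\<lambda>y. y /\<^sub>R norm y) has_derivative (\<lambda>h. h - (x \<bullet> h) *\<^sub>R x)) (at x)"
    using nx by simp
  hence sgn: "(sgn has_derivative (\<lambda>h. h - (x \<bullet> h) *\<^sub>R x)) (at x)"
    by (simp add: sgn_div_norm[abs_def])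
  have DF: "(F has_derivative frechet_derivative F (at x)) (at (sgn x))"
    using F frechet_derivative_works sgn_x x_def by auto
  have "((\<lambda>y. F (sgn y)) has_derivative (\<lambda>h. frechet_derivative F (at x) (h - (x \<bullet> h) *\<^sub>R x))) (at x)"
    using has_derivative_compose[OF sgn DF] .
  hence D: "((\<lambda>y. f (radial_proj y)) has_derivative
           (\<lambda>h. frechet_derivative F (at x) (h - (x \<bullet> h) *\<^sub>R x))) (at x)"
    by (rule has_derivative_transform_within_open[of _ _ _ _ "- {0}"])
       (use nx in \<open>auto simp flip: agree simp: Rep_radial_proj\<close>)
  show ?thesis
    using theta_amb_eq_frechet_derivative[OF differentiableI[OF D], of k]
      theta_amb_eq_frechet_derivative[OF F, of k] frechet_derivative_at[OF D, symmetric]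
    by (simp add: theta_s3_def theta_vec_tangent flip: x_def)
qed


section \<open>Spinors, cochains and the cocycles\<close>

type_synonym spinor = "s3 \<Rightarrow> complex \<times> complex"

definition S3H :: "spinor set" where
  "S3H = {\<phi>. smooth_s3 (\<lambda>p. fst (\<phi> p)) \<and> smooth_s3 (\<lambda>p. snd (\<phi> p))}"

definition sp_add :: "spinor \<Rightarrow> spinor \<Rightarrow> spinor" where
  "sp_add \<phi> \<psi> = (\<lambda>p. \<phi> p + \<psi> p)"

definition sp_scale :: "real \<Rightarrow> spinor \<Rightarrow> spinor" where
  "sp_scale r \<phi> = (\<lambda>p. r *\<^sub>R \<phi> p)"

definition sp_mult :: "spinor \<Rightarrow> spinor \<Rightarrow> spinor" where
  "sp_mult \<phi> \<psi> = (\<lambda>p. qmult (\<phi> p) (\<psi> p))"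

definition sp_bracket :: "spinor \<Rightarrow> spinor \<Rightarrow> spinor" where
  "sp_bracket \<phi> \<psi> = (\<lambda>p. sp_mult \<phi> \<psi> p - sp_mult \<psi> \<phi> p)"

text \<open>Cochains are maps on \<^const>\<open>S3H\<close>; their values elsewhere are irrelevant.\<close>

definition cochain1 :: "(spinor \<Rightarrow> complex) \<Rightarrow> bool" where
  "cochain1 b \<longleftrightarrow>
     (\<forall>\<phi>\<in>S3H. \<forall>\<psi>\<in>S3H. b (sp_add \<phi> \<psi>) = b \<phi> + b \<psi>) \<and>
     (\<forall>r. \<forall>\<phi>\<in>S3H. b (sp_scale r \<phi>) = r *\<^sub>R b \<phi>)"

definition cochain2 :: "(spinor \<Rightarrow> spinor \<Rightarrow> complex) \<Rightarrow> bool" where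
  "cochain2 c \<longleftrightarrow> (\<forall>\<phi>\<in>S3H. cochain1 (c \<phi>)) \<and> (\<forall>\<psi>\<in>S3H. cochain1 (\<lambda>\<phi>. c \<phi> \<psi>))"

definition Theta :: "nat \<Rightarrow> spinor \<Rightarrow> spinor" where
  "Theta k \<phi> = (\<lambda>p. (1 / 2 * theta_s3 k (\<lambda>q. fst (\<phi> q)) p, 1 / 2 * theta_s3 k (\<lambda>q. snd (\<phi> q)) p))"

definition ck :: "nat \<Rightarrow> spinor \<Rightarrow> spinor \<Rightarrow> complex" where
  "ck k \<phi> \<psi> = 1 / (2 * of_real pi ^ 2) * (\<integral>p. qtr (sp_mult (Theta k \<phi>) \<psi> p) \<partial>sigma3)"

end

theory Submission
  imports Defs
begin

text \<open>
  The fields \<open>\<theta>\<^sub>k\<close> are generated by one-parameter groups of isometries of \<open>S\<^sup>3\<close>, so \<open>\<integral> \<theta>\<^sub>k f d\<sigma> = 0\<close>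
  for every \<open>C\<^sup>1\<close> function \<open>f\<close>.  Since \<open>\<theta>\<^sub>k\<close> is a real derivation and the trace is cyclic, skew symmetry
  and the cocycle identity are this statement for the traces of \<open>\<phi>\<^sub>1 \<phi>\<^sub>2\<close> and \<open>\<phi>\<^sub>1 \<phi>\<^sub>2 \<phi>\<^sub>3\<close>.  A coboundary
  vanishes on commuting pairs, whereas \<open>c\<^sub>k(z\<^sub>1, cnj (\<theta>\<^sub>k z\<^sub>1)) + c\<^sub>k(z\<^sub>2, cnj (\<theta>\<^sub>k z\<^sub>2)) = 1\<close>, because \<open>\<theta>\<^sub>k\<close> has
  unit length.

  These rotations are products of shears, which preserve Lebesgue measure by Fubini's theorem and translation
  invariance.
\<close>


section \<open>Invariance of Lebesgue measure under shears\<close>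

text \<open>For fixed second coordinate \<open>y\<close> the map translates the slice by
  \<open>g y\<close>, which preserves its measure. Integrating the measures of the slices over
  \<open>y\<close> (Fubini) gives the claim.\<close>

lemma distr_lborel_shear_fst:
  fixes g :: "'b::euclidean_space \<Rightarrow> 'a::euclidean_space"
  assumes [measurable]: "g \<in> borel_measurable borel"
  shows "distr lborel borel (\<lambda>z. (fst z + g (snd z), snd z)) = lborel"
proof (rule measure_eqI)
  fix A :: "('a \<times> 'b) set" assume "A \<in> sets (distr lborel borel (\<lambda>z. (fst z + g (snd z), snd z)))"
  hence [measurable]: "A \<in> sets (borel \<Otimes>\<^sub>M borel)" and A: "A \<in> sets borel"
    by (simp_all flip: borel_prod)
  let ?B = "{z. (fst z + g (snd z), snd z) \<in> A}"
  have "(\<lambda>z. (fst z + g (snd z), snd z)) \<in> borel \<Otimes>\<^sub>M borel \<rightarrow>\<^sub>M borel \<Otimes>\<^sub>M borel"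
    by measurable
  hence "(\<lambda>z. (fst z + g (snd z), snd z)) -` A \<inter> space (borel \<Otimes>\<^sub>M borel) \<in> sets (borel \<Otimes>\<^sub>M borel)"
    by (rule measurable_sets) measurable
  hence B: "?B \<in> sets (lborel \<Otimes>\<^sub>M lborel)"
    by (simp add: vimage_def space_pair_measure cong: sets_pair_measure_cong)
  have slice: "emeasure lborel {x. (x + g y, y) \<in> A} = emeasure lborel {x. (x, y) \<in> A}" for y
  proof -
    have [measurable]: "{x. (x, y) \<in> A} \<in> sets borel"
      by measurable
    have "emeasure lborel {x. (x, y) \<in> A} = emeasure (distr lborel borel ((+) (g y))) {x. (x, y) \<in> A}"
      by (simp add: lborel_distr_plus)
    also have "\<dots> = emeasure lborel {x. (x + g y, y) \<in> A}"
      by (subst emeasure_distr) (auto simp: add.commute vimage_def)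
    finally show ?thesis ..
  qed
  have "emeasure (distr lborel borel (\<lambda>z. (fst z + g (snd z), snd z))) A = emeasure lborel ?B"
    using A by (subst emeasure_distr)
      (auto simp: vimage_def space_pair_measure borel_prod [symmetric] lborel_prod [symmetric])
  also have "\<dots> = (\<integral>\<^sup>+y. emeasure lborel ((\<lambda>x. (x, y)) -` ?B) \<partial>lborel)"
    using lborel_pair.emeasure_pair_measure_alt2[OF B] by (simp add: lborel_prod)
  also have "\<dots> = (\<integral>\<^sup>+y. emeasure lborel ((\<lambda>x. (x, y)) -` A) \<partial>lborel)"
    by (simp add: vimage_def slice)
  also have "\<dots> = emeasure lborel A"
    using lborel_pair.emeasure_pair_measure_alt2[of A] A by (simp add: lborel_prod)
  finally show "emeasure (distr lborel borel (\<lambda>z. (fst z + g (snd z), snd z))) A = emeasure lborel A" .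
qed simp

lemma distr_lborel_swap:
  "distr lborel borel (\<lambda>z. (snd z, fst z)) = (lborel :: ('a::euclidean_space \<times> 'b::euclidean_space) measure)"
  using lborel_pair.distr_pair_swap[where 'a = 'a and 'b = 'b]
  by (simp add: lborel_prod case_prod_unfold cong: distr_cong flip: borel_prod)

lemma distr_lborel_compose:
  assumes "f \<in> borel_measurable borel" "g \<in> borel_measurable borel"
    and "distr lborel borel f = lborel" "distr lborel borel g = lborel"
  shows "distr lborel borel (\<lambda>x. f (g x)) = lborel"
  using distr_distr[of f borel borel g lborel] assms by (simp add: comp_def)

text \<open>This is the shear of the first coordinate conjugated by the coordinate swap, and both
  preserve Lebesgue measure.\<close>

lemma distr_lborel_shear_snd:
  fixes g :: "'a::euclidean_space \<Rightarrow> 'b::euclidean_space"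
  assumes [measurable]: "g \<in> borel_measurable borel"
  shows "distr lborel borel (\<lambda>z. (fst z, snd z + g (fst z))) = lborel"
proof -
  have [measurable]: "(\<lambda>w. (snd w, fst w)) \<in> borel_measurable (borel :: ('b \<times> 'a) measure)"
      "(\<lambda>w. (snd w, fst w)) \<in> borel_measurable (borel :: ('a \<times> 'b) measure)"
      "(\<lambda>w. (fst w + g (snd w), snd w)) \<in> borel_measurable (borel :: ('b \<times> 'a) measure)"
    by (simp_all flip: borel_prod)
  have "lborel = distr lborel borel (\<lambda>w. (snd w, fst w))"
    by (rule distr_lborel_swap[symmetric])
  also have "\<dots> = distr (distr lborel borel (\<lambda>w. (fst w + g (snd w), snd w))) borel (\<lambda>w. (snd w, fst w))"
    by (simp add: distr_lborel_shear_fst)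
  also have "\<dots> = distr (distr (distr lborel borel (\<lambda>w. (snd w, fst w))) borel
       (\<lambda>w. (fst w + g (snd w), snd w))) borel (\<lambda>w. (snd w, fst w))"
    by (simp only: distr_lborel_swap)
  also have "\<dots> = distr lborel borel (\<lambda>z. (fst z, snd z + g (fst z)))"
    by (subst distr_distr, measurable, subst distr_distr, measurable) (simp add: comp_def)
  finally show ?thesis ..
qed

section \<open>The rotations generated by the vector fields, on the ambient space and on the
  sphere\<close>

text \<open>Since \<open>theta_vec k\<close> squares to minus the identity, its flow at time
  \<open>t\<close> is \<open>rot k (cos t) (sin t)\<close>. The coefficients stay free so that
  algebraic identities between rotations need no trigonometry.\<close>

definition rot :: "nat \<Rightarrow> real \<Rightarrow> real \<Rightarrow> complex \<times> complex \<Rightarrow> complex \<times> complex" where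
  "rot k c s x = c *\<^sub>R x + s *\<^sub>R theta_vec k x"

lemma linear_theta_vec: "linear (theta_vec k)"
  by (rule linearI) (auto simp: theta_vec_def algebra_simps scaleR_conv_of_real)

lemma theta_vec_theta_vec: "theta_vec k (theta_vec k x) = - x"
  by (auto simp: theta_vec_def case_prod_unfold prod_eq_iff)

lemma norm_theta_vec [simp]: "norm (theta_vec k x) = norm x"
  by (auto simp: theta_vec_def case_prod_unfold norm_Pair norm_prod_def norm_mult add.commute)

text \<open>The vectors \<open>x\<close> and \<open>theta_vec k x\<close> are orthogonal and of
  equal length, so Pythagoras applies.\<close>

lemma norm_rot:
  assumes "c\<^sup>2 + s\<^sup>2 = 1"
  shows "norm (rot k c s x) = norm x"
proof -
  have "(norm (rot k c s x))\<^sup>2 = (norm (c *\<^sub>R x))\<^sup>2 + (norm (s *\<^sub>R theta_vec k x))\<^sup>2"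
    unfolding rot_def by (rule norm_add_Pythagorean) (simp add: orthogonal_def theta_vec_tangent)
  also have "\<dots> = (c\<^sup>2 + s\<^sup>2) * (norm x)\<^sup>2"
    by (simp add: power_mult_distrib algebra_simps)
  finally show ?thesis using assms by simp
qed

lemma continuous_on_theta_vec [continuous_intros]:
  "continuous_on S f \<Longrightarrow> continuous_on S (\<lambda>x. theta_vec k (f x))"
  unfolding theta_vec_def case_prod_unfold
  by (cases "k = 0"; cases "k = 1") (auto intro!: continuous_intros)

lemma continuous_on_rot: "continuous_on S (rot k c s)"
  unfolding rot_def by (intro continuous_intros)

lemma measurable_rot [measurable]: "rot k c s \<in> borel_measurable borel"
  by (intro borel_measurable_continuous_onI continuous_on_rot)

text \<open>For \<open>k \<noteq> 0\<close> the rotation is \<open>(x, y) \<mapsto> (c x + s \<tau> y, c y - s \<tau> x)\<close> with \<open>\<tau> \<tau> = id\<close>, a product of three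
  shears.  The case \<open>k = 0\<close> is conjugate to \<open>k = 2\<close> by a rotation by \<open>\<pi>/4\<close> with \<open>k = 1\<close>.\<close>

lemma distr_lborel_rot:
  assumes "c\<^sup>2 + s\<^sup>2 = 1" "s \<noteq> 0"
  shows "distr lborel borel (rot k c s) = lborel"
proof -
  have *: "distr lborel borel (rot k c s) = lborel" if "k \<noteq> 0" "c\<^sup>2 + s\<^sup>2 = 1" "s \<noteq> 0" for k c s
  proof -
    define \<tau> where "\<tau> z = fst (theta_vec k (0, z))" for z
    have \<tau>: "linear \<tau>" "\<tau> (\<tau> z) = z" for z
      using \<open>k \<noteq> 0\<close> by (auto intro!: linearI simp: theta_vec_def \<tau>_def algebra_simps scaleR_conv_of_real)
    interpret linear \<tau> by fact
    have J: "theta_vec k z = (\<tau> (snd z), - \<tau> (fst z))" for z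
      using \<open>k \<noteq> 0\<close> by (auto simp: theta_vec_def \<tau>_def case_prod_unfold)
    have m [measurable]: "\<tau> \<in> borel_measurable borel"
      using \<tau>(1) by (intro borel_measurable_continuous_onI linear_continuous_on)
        (simp add: linear_conv_bounded_linear)
    \<comment> \<open>For \<open>c = cos t\<close> and \<open>s = sin t\<close> this is
      \<open>tan (t / 2)\<close>, the coefficient in the classical factorization of a rotation into
      three shears. It solves \<open>1 - s * a = c\<close>; the second relation
      \<open>a * (1 + c) = s\<close> then follows from \<open>c\<^sup>2 + s\<^sup>2 = 1\<close>. The
      division is where \<open>s \<noteq> 0\<close> enters.\<close>
    define a where "a = (1 - c) / s"
    have a: "s * a = 1 - c" "a * (1 + c) = s"
      using that by (auto simp: a_def field_simps power2_eq_square)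
    define S1 where "S1 z = (fst z + a *\<^sub>R \<tau> (snd z), snd z)" for z
    define S2 where "S2 z = (fst z, snd z + (- s) *\<^sub>R \<tau> (fst z))" for z
    have meas: "S1 \<in> borel_measurable borel" "S2 \<in> borel_measurable borel"
      unfolding S1_def[abs_def] S2_def[abs_def] borel_prod[symmetric] by measurable
    have S: "distr lborel borel S1 = lborel" "distr lborel borel S2 = lborel"
      unfolding S1_def[abs_def] S2_def[abs_def]
      by (rule distr_lborel_shear_fst distr_lborel_shear_snd; measurable)+
    have "rot k c s z = S1 (S2 (S1 z))" for z
    proof -
      have c: "1 - s * a = c" and s: "a + a * c = s"
        using a by (auto simp: algebra_simps)
      have "S1 (S2 (S1 z)) = ((1 - s * a) *\<^sub>R fst z + (a + a * (1 - s * a)) *\<^sub>R \<tau> (snd z),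
           (1 - s * a) *\<^sub>R snd z - s *\<^sub>R \<tau> (fst z))"
        by (simp add: S1_def S2_def add diff neg scaleR \<tau>(2) algebra_simps) (simp add: scaleR_conv_of_real)
      also have "\<dots> = (c *\<^sub>R fst z + s *\<^sub>R \<tau> (snd z), c *\<^sub>R snd z - s *\<^sub>R \<tau> (fst z))"
        by (simp only: c s)
      also have "\<dots> = rot k c s z"
        by (simp add: rot_def J prod_eq_iff)
      finally show ?thesis ..
    qed
    hence "rot k c s = (\<lambda>z. S1 (S2 (S1 z)))"
      by (rule ext)
    moreover have "distr lborel borel (\<lambda>z. S1 (S2 (S1 z))) = lborel"
      using distr_lborel_compose[OF meas(1) measurable_compose[OF meas] S(1)
          distr_lborel_compose[OF meas(2,1) S(2,1)]] .
    ultimately show ?thesis by simp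
  qed
  show ?thesis
  proof (cases "k = 0")
    case False
    thus ?thesis using *[OF _ assms] by simp
  next
    case True
    define r where "r = sqrt (1 / 2)"
    have r: "r\<^sup>2 = 1 / 2" "r \<noteq> 0"
      by (auto simp: r_def)
    have "rot 0 c s z = rot 1 r r (rot 2 c (- s) (rot 1 r (- r) z))" for z
    proof -
      \<comment> \<open>The two factors \<open>r\<close> are pulled out of the outer rotations,
        which leaves an identity with coefficients 1, \<open>c\<close> and \<open>s\<close>; at the
        end \<open>r\<^sup>2 * 2 = 1\<close>.\<close>
      have 1: "rot 1 r (- r) z = r *\<^sub>R rot 1 1 (- 1) z" "rot 1 r r w = r *\<^sub>R rot 1 1 1 w" for w
        by (simp_all add: rot_def scaleR_add_right scaleR_diff_right)
      have 2: "rot k c s (r *\<^sub>R w) = r *\<^sub>R rot k c s w" for k c s w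
        by (simp add: rot_def linear_scale[OF linear_theta_vec] scaleR_add_right mult.commute)
      \<comment> \<open>The maps \<open>theta_vec 1\<close> and \<open>theta_vec 2\<close>
        anticommute, and \<open>theta_vec 1\<close> after \<open>theta_vec 2\<close> is minus
        \<open>theta_vec 0\<close>. Hence the sign in \<open>rot 2 c (- s)\<close>.\<close>
      have 3: "rot 1 1 1 (rot 2 c (- s) (rot 1 1 (- 1) z)) = 2 *\<^sub>R rot 0 c s z"
        by (simp add: rot_def theta_vec_def case_prod_unfold prod_eq_iff scaleR_2 algebra_simps)
          (simp add: scaleR_conv_of_real)
      have "rot 1 r r (rot 2 c (- s) (rot 1 r (- r) z)) = r\<^sup>2 *\<^sub>R 2 *\<^sub>R rot 0 c s z"
        by (simp only: 1 2 3 power2_eq_square scaleR_scaleR mult.assoc)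
      thus ?thesis
        by (simp add: r(1))
    qed
    hence "rot 0 c s = (\<lambda>z. rot 1 r r (rot 2 c (- s) (rot 1 r (- r) z)))"
      by (rule ext)
    moreover have "distr lborel borel (\<lambda>z. rot 1 r r (rot 2 c (- s) (rot 1 r (- r) z))) = lborel"
      using distr_lborel_compose[OF measurable_rot measurable_compose[OF measurable_rot measurable_rot]
          * distr_lborel_compose[OF measurable_rot measurable_rot * *]] r assms by simp
    ultimately show ?thesis using True by simp
  qed
qed

text \<open>For \<open>c\<^sup>2 + s\<^sup>2 = 1\<close> the rotated point already has norm 1, so
  \<open>radial_proj\<close> merely returns it to the type \<open>s3\<close>.\<close>

definition rot_s3 :: "nat \<Rightarrow> real \<Rightarrow> real \<Rightarrow> s3 \<Rightarrow> s3" where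
  "rot_s3 k c s p = radial_proj (rot k c s (Rep_s3 p))"

lemma Rep_rot_s3:
  assumes "c\<^sup>2 + s\<^sup>2 = 1"
  shows "Rep_s3 (rot_s3 k c s p) = rot k c s (Rep_s3 p)"
proof -
  have "norm (rot k c s (Rep_s3 p)) = 1"
    by (simp add: norm_rot assms)
  moreover from this have "rot k c s (Rep_s3 p) \<noteq> 0"
    by auto
  ultimately show ?thesis
    by (simp add: rot_s3_def Rep_radial_proj sgn_div_norm)
qed

lemma sets_sigma3: "sets sigma3 = sets (vimage_algebra UNIV Rep_s3 borel)"
  by (simp add: sigma3_def)

lemma measurable_Rep_s3 [measurable]: "Rep_s3 \<in> borel_measurable sigma3"
  using measurable_vimage_algebra1[of Rep_s3 UNIV borel] measurable_cong_sets[OF sets_sigma3 refl]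
  by auto

lemma measurable_into_sigma3:
  assumes "(\<lambda>x. Rep_s3 (f x)) \<in> borel_measurable M"
  shows "f \<in> measurable M sigma3"
  using measurable_vimage_algebra2[of f M UNIV Rep_s3 borel] measurable_cong_sets[OF refl sets_sigma3] assms
  by auto

text \<open>Up to the factor 4, \<open>sigma3 A\<close> is the volume of the cone over
  \<open>A\<close>. The rotation is linear and preserves norms, so it commutes with
  \<open>radial_proj\<close>. Therefore the cone over a preimage is the preimage of the cone, and
  the invariance of Lebesgue measure carries over.\<close>

lemma distr_sigma3_rot_s3:
  assumes cs: "c\<^sup>2 + s\<^sup>2 = 1" "s \<noteq> 0"
  shows "distr sigma3 sigma3 (rot_s3 k c s) = sigma3"
proof (rule measure_eqI)
  have meas: "rot_s3 k c s \<in> measurable sigma3 sigma3"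
    by (rule measurable_into_sigma3) (simp add: Rep_rot_s3[OF cs(1)])
  fix A assume "A \<in> sets (distr sigma3 sigma3 (rot_s3 k c s))"
  hence A: "A \<in> sets sigma3" by simp
  let ?B = "ball 0 1 - {0} :: (complex \<times> complex) set"
  have "rot_s3 k c s (radial_proj x) = radial_proj (rot k c s x)" if "x \<noteq> 0" for x
  proof -
    have n: "norm (rot k c s x) = norm x"
      by (simp add: norm_rot cs)
    have nz: "rot k c s x \<noteq> 0"
      using that n by (metis norm_eq_zero)
    have "rot k c s (sgn x) = sgn (rot k c s x)"
      using linear_scale[OF linear_theta_vec] n
      by (simp add: rot_def sgn_div_norm scaleR_add_right mult.commute)
    hence "Rep_s3 (rot_s3 k c s (radial_proj x)) = Rep_s3 (radial_proj (rot k c s x))"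
      using that nz by (simp add: Rep_rot_s3[OF cs(1)] Rep_radial_proj)
    thus ?thesis by (simp add: Rep_s3_inject)
  qed
  moreover have "norm (rot k c s x) = norm x" for x
    by (simp add: norm_rot cs)
  moreover have "rot k c s x = 0 \<longleftrightarrow> x = 0" for x
    using norm_rot[OF cs(1), of k x] by (metis norm_eq_zero)
  ultimately have eq: "{x \<in> ?B. radial_proj x \<in> rot_s3 k c s -` A} = rot k c s -` {x \<in> ?B. radial_proj x \<in> A}"
    by auto
  have S: "{x \<in> ?B. radial_proj x \<in> A} \<in> sets borel"
  proof -
    have "radial_proj -` A \<inter> space (restrict_space lborel ?B) \<in> sets (restrict_space lborel ?B)"
      using A by (intro measurable_sets[OF measurable_radial_proj]) (simp add: sets_sigma3)
    thus ?thesis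
      by (auto simp: sets_restrict_space_iff space_restrict_space vimage_def Int_def conj_commute)
  qed
  have "emeasure (distr sigma3 sigma3 (rot_s3 k c s)) A = emeasure sigma3 (rot_s3 k c s -` A)"
    using meas A by (simp add: emeasure_distr)
  also have "\<dots> = 4 * emeasure lborel (rot k c s -` {x \<in> ?B. radial_proj x \<in> A})"
    using measurable_sets[OF meas A] unfolding eq[symmetric] by (intro emeasure_sigma3) simp
  also have "\<dots> = 4 * emeasure (distr lborel borel (rot k c s)) {x \<in> ?B. radial_proj x \<in> A}"
    using S by (subst emeasure_distr) auto
  also have "\<dots> = emeasure sigma3 A"
    using A by (simp add: distr_lborel_rot[OF cs] emeasure_sigma3)
  finally show "emeasure (distr sigma3 sigma3 (rot_s3 k c s)) A = emeasure sigma3 A" .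
qed simp


section \<open>Functions of class C1 on the sphere and the derivation rules for the fields\<close>

text \<open>This is \<open>smooth_s3\<close> cut off at order one. The arguments below differentiate
  only once, and at this order closure under products is the plain product rule, without an
  induction over the order of differentiability.\<close>

definition C1_s3 :: "(s3 \<Rightarrow> complex) \<Rightarrow> bool" where
  "C1_s3 f \<longleftrightarrow> (\<exists>U F. open U \<and> sphere 0 1 \<subseteq> U \<and> (\<forall>x\<in>U. F differentiable (at x)) \<and>
     (\<forall>v. continuous_on U (\<lambda>x. frechet_derivative F (at x) v)) \<and> (\<forall>p. F (Rep_s3 p) = f p))"

lemma C1_s3I:
  assumes "open U" "sphere 0 1 \<subseteq> U" "\<And>x. x \<in> U \<Longrightarrow> (F has_derivative F' x) (at x)"
    and "\<And>v. continuous_on U (\<lambda>x. F' x v)" "\<And>p. F (Rep_s3 p) = f p"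
  shows "C1_s3 f"
proof -
  have "frechet_derivative F (at x) = F' x" if "x \<in> U" for x
    using frechet_derivative_at[OF assms(3)[OF that]] by simp
  hence "continuous_on U (\<lambda>x. frechet_derivative F (at x) v)" for v
    using assms(4)[of v] by (simp cong: continuous_on_cong)
  thus ?thesis
    using assms unfolding C1_s3_def differentiable_def by blast
qed

text \<open>By \<open>theta_s3_extension\<close> the radial extension in \<open>theta_s3\<close> may
  be exchanged for the given extension \<open>F\<close>. From here on \<open>theta_s3 k f\<close> is
  the derivative of \<open>F\<close> in the direction \<open>theta_vec k\<close>.\<close>

lemma C1_s3E:
  assumes "C1_s3 f"
  obtains U F F' where "open U" "sphere 0 1 \<subseteq> U"
    "\<And>x. x \<in> U \<Longrightarrow> (F has_derivative F' x) (at x)" "\<And>v. continuous_on U (\<lambda>x. F' x v)"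
    "\<And>p. F (Rep_s3 p) = f p" "\<And>p. theta_s3 k f p = F' (Rep_s3 p) (theta_vec k (Rep_s3 p))"
proof -
  from assms obtain U F where U: "open U" "sphere 0 1 \<subseteq> U" "\<And>x. x \<in> U \<Longrightarrow> F differentiable (at x)"
    "\<And>v. continuous_on U (\<lambda>x. frechet_derivative F (at x) v)" "\<And>p. F (Rep_s3 p) = f p"
    unfolding C1_s3_def by blast
  have "theta_s3 k f p = frechet_derivative F (at (Rep_s3 p)) (theta_vec k (Rep_s3 p))" for p
  proof -
    have "Rep_s3 p \<in> U"
      using U(2) by auto
    thus ?thesis
      using U(3,5) by (simp add: theta_s3_extension[of F] theta_amb_eq_frechet_derivative)
  qed
  thus ?thesis
    using that[of U F "\<lambda>x. frechet_derivative F (at x)"] U frechet_derivative_works by blast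
qed

lemma theta_s3_eqI:
  assumes "(F has_derivative F') (at (Rep_s3 p))" "\<And>q. F (Rep_s3 q) = f q"
  shows "theta_s3 k f p = F' (theta_vec k (Rep_s3 p))"
proof -
  have d: "F differentiable (at (Rep_s3 p))"
    using assms(1) by (rule differentiableI)
  show ?thesis
    using theta_s3_extension[OF d assms(2)] theta_amb_eq_frechet_derivative[OF d]
      frechet_derivative_at[OF assms(1)] by simp
qed

lemma smooth_s3_imp_C1_s3: "smooth_s3 f \<Longrightarrow> C1_s3 f"
proof -
  assume "smooth_s3 f"
  then obtain U F where "open U" "sphere 0 1 \<subseteq> U" "\<forall>n. C_diff_on n U F" "\<forall>p. F (Rep_s3 p) = f p"
    unfolding smooth_s3_def by blast
  thus "C1_s3 f"
    unfolding C1_s3_def by (intro exI[of _ U] exI[of _ F]) (auto dest: spec[of _ "Suc 0"])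
qed

text \<open>The derivative is taken along a real direction \<open>theta_vec k\<close>, so it
  commutes with conjugation. This fails for \<open>e_plus\<close> and \<open>e_minus\<close>
  separately, which conjugation exchanges.\<close>

lemma
  assumes "C1_s3 f"
  shows C1_s3_cnj: "C1_s3 (\<lambda>p. cnj (f p))"
    and theta_s3_cnj: "theta_s3 k (\<lambda>p. cnj (f p)) p = cnj (theta_s3 k f p)"
proof -
  from assms obtain U F F' where F: "open U" "sphere 0 1 \<subseteq> U"
    "\<And>x. x \<in> U \<Longrightarrow> (F has_derivative F' x) (at x)" "\<And>v. continuous_on U (\<lambda>x. F' x v)"
    "\<And>p. F (Rep_s3 p) = f p" "\<And>p. theta_s3 k f p = F' (Rep_s3 p) (theta_vec k (Rep_s3 p))"
    by (rule C1_s3E[where k = k]) auto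
  have d: "((\<lambda>x. cnj (F x)) has_derivative (\<lambda>v. cnj (F' x v))) (at x)" if "x \<in> U" for x
    using F(3)[OF that] by (rule has_derivative_cnj)
  show "C1_s3 (\<lambda>p. cnj (f p))"
    by (rule C1_s3I[OF F(1,2) d], assumption) (intro continuous_intros F(4), simp_all add: F(5))
  have "Rep_s3 p \<in> U" using F(2) by auto
  from theta_s3_eqI[OF d[OF this], of "\<lambda>p. cnj (f p)" k] show "theta_s3 k (\<lambda>p. cnj (f p)) p = cnj (theta_s3 k f p)"
    by (simp add: F(5,6))
qed

lemma
  assumes "C1_s3 f" "C1_s3 g"
  shows C1_s3_add: "C1_s3 (\<lambda>p. f p + g p)"
    and theta_s3_add: "theta_s3 k (\<lambda>p. f p + g p) p = theta_s3 k f p + theta_s3 k g p"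
    and C1_s3_mult: "C1_s3 (\<lambda>p. f p * g p)"
    and theta_s3_mult: "theta_s3 k (\<lambda>p. f p * g p) p = theta_s3 k f p * g p + f p * theta_s3 k g p"
proof -
  from assms obtain U F F' where F: "open U" "sphere 0 1 \<subseteq> U"
    "\<And>x. x \<in> U \<Longrightarrow> (F has_derivative F' x) (at x)" "\<And>v. continuous_on U (\<lambda>x. F' x v)"
    "\<And>p. F (Rep_s3 p) = f p" "\<And>p. theta_s3 k f p = F' (Rep_s3 p) (theta_vec k (Rep_s3 p))"
    by (elim C1_s3E[where k = k]) blast
  from assms obtain V G G' where G: "open V" "sphere 0 1 \<subseteq> V"
    "\<And>x. x \<in> V \<Longrightarrow> (G has_derivative G' x) (at x)" "\<And>v. continuous_on V (\<lambda>x. G' x v)"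
    "\<And>p. G (Rep_s3 p) = g p" "\<And>p. theta_s3 k g p = G' (Rep_s3 p) (theta_vec k (Rep_s3 p))"
    by (elim C1_s3E[where k = k]) blast
  have W: "open (U \<inter> V)" "sphere 0 1 \<subseteq> U \<inter> V"
    using F G by auto
  have cont: "continuous_on (U \<inter> V) F" "continuous_on (U \<inter> V) G"
    by (auto intro!: continuous_at_imp_continuous_on has_derivative_continuous[OF F(3)]
          has_derivative_continuous[OF G(3)])
  have cont': "continuous_on (U \<inter> V) (\<lambda>x. F' x v)" "continuous_on (U \<inter> V) (\<lambda>x. G' x v)" for v
    by (rule continuous_on_subset[OF F(4)], simp) (rule continuous_on_subset[OF G(4)], simp)
  have add: "((\<lambda>x. F x + G x) has_derivative (\<lambda>v. F' x v + G' x v)) (at x)" if "x \<in> U \<inter> V" for x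
    using that by (intro has_derivative_add F(3) G(3)) auto
  have mult: "((\<lambda>x. F x * G x) has_derivative (\<lambda>v. F x * G' x v + F' x v * G x)) (at x)" if "x \<in> U \<inter> V" for x
    using that by (intro has_derivative_mult F(3) G(3)) auto
  show "C1_s3 (\<lambda>p. f p + g p)"
    by (rule C1_s3I[OF W add], assumption) (intro continuous_intros cont', simp_all add: F(5) G(5))
  show "C1_s3 (\<lambda>p. f p * g p)"
    by (rule C1_s3I[OF W mult], assumption) (intro continuous_intros cont cont', simp_all add: F(5) G(5))
  have p: "Rep_s3 p \<in> U \<inter> V" using W(2) by auto
  from theta_s3_eqI[OF add[OF p], of "\<lambda>p. f p + g p" k]
  show "theta_s3 k (\<lambda>p. f p + g p) p = theta_s3 k f p + theta_s3 k g p"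
    by (simp add: F(5,6) G(5,6))
  from theta_s3_eqI[OF mult[OF p], of "\<lambda>p. f p * g p" k]
  show "theta_s3 k (\<lambda>p. f p * g p) p = theta_s3 k f p * g p + f p * theta_s3 k g p"
    by (simp add: F(5,6) G(5,6))
qed

lemma theta_s3_linear:
  assumes "linear L"
  shows "theta_s3 k (\<lambda>p. L (Rep_s3 p)) p = L (theta_vec k (Rep_s3 p))"
  by (rule theta_s3_eqI) (use assms in \<open>auto intro: linear_imp_has_derivative\<close>)

lemma
  shows C1_s3_const: "C1_s3 (\<lambda>p. c)"
    and theta_s3_const: "theta_s3 k (\<lambda>p. c) p = 0"
proof -
  have d: "((\<lambda>x. c) has_derivative (\<lambda>_. 0)) (at x)" for x :: "complex \<times> complex"
    by simp
  show "C1_s3 (\<lambda>p. c)"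
    by (rule C1_s3I[of UNIV "\<lambda>_. c" "\<lambda>_ _. 0"]) auto
  show "theta_s3 k (\<lambda>p. c) p = 0"
    using theta_s3_eqI[OF d] by simp
qed

section \<open>Continuity and integration on the sphere\<close>

text \<open>The type \<open>s3\<close> carries no topology of its own, so continuity refers to the
  function transported to the sphere in the ambient space.\<close>

definition cont_s3 :: "(s3 \<Rightarrow> complex) \<Rightarrow> bool" where
  "cont_s3 h \<longleftrightarrow> continuous_on (sphere 0 1) (\<lambda>x. h (Abs_s3 x))"

lemma cont_s3_intros:
  "cont_s3 (\<lambda>p. c)"
  "cont_s3 f \<Longrightarrow> cont_s3 g \<Longrightarrow> cont_s3 (\<lambda>p. f p + g p)"
  "cont_s3 f \<Longrightarrow> cont_s3 g \<Longrightarrow> cont_s3 (\<lambda>p. f p - g p)"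
  "cont_s3 f \<Longrightarrow> cont_s3 g \<Longrightarrow> cont_s3 (\<lambda>p. f p * g p)"
  "cont_s3 f \<Longrightarrow> cont_s3 (\<lambda>p. cnj (f p))"
  unfolding cont_s3_def by (intro continuous_intros; assumption)+

lemma cont_s3_C1_s3:
  assumes "C1_s3 f"
  shows "cont_s3 f" "cont_s3 (theta_s3 k f)"
proof -
  from assms obtain U F F' where F: "open U" "sphere 0 1 \<subseteq> U"
    "\<And>x. x \<in> U \<Longrightarrow> (F has_derivative F' x) (at x)" "\<And>v. continuous_on U (\<lambda>x. F' x v)"
    "\<And>p. F (Rep_s3 p) = f p" "\<And>p. theta_s3 k f p = F' (Rep_s3 p) (theta_vec k (Rep_s3 p))"
    by (elim C1_s3E[where k = k]) blast
  have "continuous_on U F"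
    by (intro continuous_at_imp_continuous_on ballI has_derivative_continuous[OF F(3)])
  hence "continuous_on (sphere 0 1) F"
    using F(2) by (rule continuous_on_subset)
  moreover have "f (Abs_s3 x) = F x" if "x \<in> sphere 0 1" for x
    using F(5)[of "Abs_s3 x"] that by (simp add: Abs_s3_inverse)
  ultimately show "cont_s3 f"
    unfolding cont_s3_def by (subst continuous_on_cong[OF refl, of _ _ F])
  \<comment> \<open>Continuity of \<open>F' x v\<close> in \<open>x\<close> is known only for fixed
    \<open>v\<close>, whereas \<open>theta_vec k x\<close> moves with \<open>x\<close>. Expanding in
    the basis leaves fixed directions with continuous coefficients.\<close>
  have lin: "F' x v = (\<Sum>b\<in>Basis. (v \<bullet> b) *\<^sub>R F' x b)" if "x \<in> sphere 0 1" for x v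
  proof -
    interpret bounded_linear "F' x"
      using F(2,3) that has_derivative_bounded_linear by blast
    have "F' x v = F' x (\<Sum>b\<in>Basis. (v \<bullet> b) *\<^sub>R b)"
      by (simp add: euclidean_representation)
    thus ?thesis
      by (simp add: sum scaleR)
  qed
  have "theta_s3 k f (Abs_s3 x) = (\<Sum>b\<in>Basis. (theta_vec k x \<bullet> b) *\<^sub>R F' x b)" if "x \<in> sphere 0 1" for x
    unfolding F(6) Abs_s3_inverse[OF that] by (rule lin[OF that])
  moreover have "continuous_on (sphere 0 1) (\<lambda>x. \<Sum>b\<in>Basis. (theta_vec k x \<bullet> b) *\<^sub>R F' x b)"
    by (intro continuous_intros continuous_on_subset[OF F(4) F(2)])
  ultimately show "cont_s3 (theta_s3 k f)"
    unfolding cont_s3_def by (metis (no_types, lifting) continuous_on_cong)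
qed

lemma finite_measure_sigma3: "finite_measure sigma3"
proof
  \<comment> \<open>\<open>measure\<close> takes the value 0 where \<open>emeasure\<close> is
    infinite, so a nonzero total measure is a finite one.\<close>
  have "measure sigma3 UNIV \<noteq> 0"
    by (simp add: measure_sigma3_UNIV)
  thus "emeasure sigma3 (space sigma3) \<noteq> \<infinity>"
    by (auto simp: measure_def)
qed

lemma cont_s3_bounded:
  assumes "cont_s3 h"
  obtains M where "\<And>p. norm (h p) \<le> M"
proof -
  have "bounded ((\<lambda>x. h (Abs_s3 x)) ` sphere 0 1)"
    using assms unfolding cont_s3_def by (intro compact_imp_bounded compact_continuous_image) auto
  then obtain M where "\<And>x. x \<in> sphere 0 1 \<Longrightarrow> norm (h (Abs_s3 x)) \<le> M"
    unfolding bounded_iff by blast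
  from this[OF Rep_s3] have "norm (h p) \<le> M" for p
    by (simp add: Rep_s3_inverse)
  thus ?thesis
    by (rule that)
qed

lemma cont_s3_measurable:
  assumes "cont_s3 h"
  shows "h \<in> borel_measurable sigma3"
proof -
  have "(\<lambda>x. if x \<in> sphere 0 1 then h (Abs_s3 x) else 0) \<in> borel_measurable borel"
    using assms unfolding cont_s3_def
    by (intro borel_measurable_continuous_on_if) auto
  from measurable_compose[OF measurable_Rep_s3 this] show ?thesis
    by (simp add: Rep_s3_inverse)
qed

lemma cont_s3_integrable:
  assumes "cont_s3 h"
  shows "integrable sigma3 h"
proof -
  obtain M where "\<And>p. norm (h p) \<le> M"
    using cont_s3_bounded[OF assms] by blast
  thus ?thesis
    using cont_s3_measurable[OF assms]
    by (intro finite_measure.integrable_const_bound[OF finite_measure_sigma3]) auto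
qed

text \<open>The difference quotients of \<open>f\<close> along the flow of \<open>\<theta>\<^sub>k\<close> have integral \<open>0\<close> and
  converge boundedly to \<open>\<theta>\<^sub>k f\<close>.\<close>

lemma integral_theta_s3:
  assumes f: "C1_s3 f"
  shows "(\<integral>p. theta_s3 k f p \<partial>sigma3) = 0"
proof -
  interpret finite_measure sigma3 by (rule finite_measure_sigma3)
  from f obtain U F F' where F: "open U" "sphere 0 1 \<subseteq> U"
    "\<And>x. x \<in> U \<Longrightarrow> (F has_derivative F' x) (at x)" "\<And>v. continuous_on U (\<lambda>x. F' x v)"
    "\<And>p. F (Rep_s3 p) = f p" "\<And>p. theta_s3 k f p = F' (Rep_s3 p) (theta_vec k (Rep_s3 p))"
    by (elim C1_s3E[where k = k]) blast
  define \<gamma> where "\<gamma> t p = rot_s3 k (cos t) (sin t) p" for t p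
  have Rep_\<gamma>: "Rep_s3 (\<gamma> t p) = rot k (cos t) (sin t) (Rep_s3 p)" for t p
    by (simp add: \<gamma>_def Rep_rot_s3)
  have \<gamma>0: "\<gamma> 0 p = p" for p
    using Rep_\<gamma>[of 0 p] by (simp add: rot_def Rep_s3_inject)
  have meas_f: "f \<in> borel_measurable sigma3" and int_f: "integrable sigma3 f"
    using f cont_s3_C1_s3 cont_s3_measurable cont_s3_integrable by blast+
  have meas_\<gamma> [measurable]: "\<gamma> t \<in> measurable sigma3 sigma3" for t
    by (rule measurable_into_sigma3) (simp add: Rep_\<gamma>)
  obtain M where M: "\<And>p. norm (theta_s3 k f p) \<le> M"
    using cont_s3_bounded[OF cont_s3_C1_s3(2)[OF f]] by blast
  have deriv: "((\<lambda>t. f (\<gamma> t p)) has_vector_derivative theta_s3 k f (\<gamma> t p)) (at t)" for t p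
  proof -
    \<comment> \<open>The orbit is an integral curve of the field: differentiating
      \<open>cos t\<close> and \<open>sin t\<close> has the same effect as applying
      \<open>theta_vec k\<close>, whose square is minus the identity.\<close>
    have *: "((\<lambda>t. Rep_s3 (\<gamma> t p)) has_vector_derivative theta_vec k (Rep_s3 (\<gamma> t p))) (at t)"
    proof -
      interpret linear "theta_vec k" by (rule linear_theta_vec)
      have "theta_vec k (Rep_s3 (\<gamma> t p)) = (- sin t) *\<^sub>R Rep_s3 p + cos t *\<^sub>R theta_vec k (Rep_s3 p)"
        by (simp add: Rep_\<gamma> rot_def add scaleR theta_vec_theta_vec)
      thus ?thesis
        unfolding Rep_\<gamma> rot_def by (auto intro!: derivative_eq_intros)
    qed
    have "Rep_s3 (\<gamma> t p) \<in> U"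
      using F(2) by auto
    from vector_derivative_diff_chain_within[OF * has_derivative_at_withinI[OF F(3)[OF this]]]
    show ?thesis
      by (simp add: comp_def F(5,6))
  qed
  \<comment> \<open>The mean value inequality along the orbit, with a constant uniform in
    \<open>p\<close>, lets the constant \<open>M\<close> dominate all difference quotients.\<close>
  have bound: "norm (f (\<gamma> t p) - f p) \<le> M * \<bar>t\<bar>" for t p
  proof -
    have "norm (f (\<gamma> t p) - f (\<gamma> 0 p)) \<le> M * norm (t - 0)"
    proof (rule differentiable_bound[OF convex_UNIV])
      fix s show "((\<lambda>t. f (\<gamma> t p)) has_derivative (\<lambda>h. h *\<^sub>R theta_s3 k f (\<gamma> s p))) (at s within UNIV)"
        using deriv by (simp add: has_vector_derivative_def)
      show "onorm (\<lambda>h. h *\<^sub>R theta_s3 k f (\<gamma> s p)) \<le> M"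
        using M by (intro onorm_le) (simp add: mult.commute[of M] mult_left_mono)
    qed auto
    thus ?thesis by (simp add: \<gamma>0)
  qed
  \<comment> \<open>These times tend to 0 and lie in the interval from 0 (excluded) to 1, below
    \<pi>. Thus \<open>sin (e n) \<noteq> 0\<close>, as the invariance of \<open>sigma3\<close>
    under the rotation demands.\<close>
  define e where "e n = 1 / (real n + 1)" for n :: nat
  have e: "e n \<noteq> 0" "sin (e n) \<noteq> 0" for n
  proof -
    have "0 < e n" "e n \<le> 1"
      by (auto simp: e_def)
    moreover have "0 < sin (e n)"
      using calculation pi_gt3 by (intro sin_gt_zero) auto
    ultimately show "e n \<noteq> 0" "sin (e n) \<noteq> 0" by auto
  qed
  have "e \<longlonglongrightarrow> 0"
    unfolding e_def using LIMSEQ_inverse_real_of_nat by (simp add: field_simps inverse_eq_divide add.commute)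
  hence lim_e: "filterlim e (at 0) sequentially"
    using e by (intro filterlim_atI) auto
  define q where "q n p = (1 / e n) *\<^sub>R (f (\<gamma> (e n) p) - f p)" for n p
  have "(\<lambda>n. \<integral>p. q n p \<partial>sigma3) \<longlonglongrightarrow> (\<integral>p. theta_s3 k f p \<partial>sigma3)"
  proof (rule integral_dominated_convergence)
    show "integrable sigma3 (\<lambda>p. M)" by simp
    show "theta_s3 k f \<in> borel_measurable sigma3"
      using f cont_s3_C1_s3 cont_s3_measurable by blast
    show "q n \<in> borel_measurable sigma3" for n
      unfolding q_def using measurable_compose[OF meas_\<gamma> meas_f] meas_f by measurable
    have "norm (q n p) \<le> M" for n p
    proof -
      have "norm (q n p) = norm (f (\<gamma> (e n) p) - f p) / \<bar>e n\<bar>"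
        by (simp add: q_def)
      thus ?thesis
        using bound[of "e n" p] e[of n] by (simp add: divide_le_eq)
    qed
    thus "AE p in sigma3. norm (q n p) \<le> M" for n
      by simp
    show "AE p in sigma3. (\<lambda>n. q n p) \<longlonglongrightarrow> theta_s3 k f p"
    proof (rule AE_I2)
      fix p
      have "((\<lambda>t. (f (\<gamma> t p) - f (\<gamma> 0 p)) /\<^sub>R t) \<longlongrightarrow> theta_s3 k f (\<gamma> 0 p)) (at 0)"
      proof -
        let ?D = "theta_s3 k f (\<gamma> 0 p)"
        have lim: "((\<lambda>t. norm ((f (\<gamma> t p) - f (\<gamma> 0 p)) - t *\<^sub>R ?D) / norm t) \<longlongrightarrow> 0) (at 0)"
          using deriv[of p 0] by (simp add: has_vector_derivative_def has_derivative_iff_norm)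
        have eq: "norm ((f (\<gamma> t p) - f (\<gamma> 0 p)) - t *\<^sub>R ?D) / norm t
            = norm ((f (\<gamma> t p) - f (\<gamma> 0 p)) /\<^sub>R t - ?D)" if "t \<noteq> 0" for t
        proof -
          have "(f (\<gamma> t p) - f (\<gamma> 0 p)) /\<^sub>R t - ?D = (f (\<gamma> t p) - f (\<gamma> 0 p) - t *\<^sub>R ?D) /\<^sub>R t"
            using that by (simp add: scaleR_diff_right)
          thus ?thesis by (simp add: divide_inverse mult.commute)
        qed
        have "((\<lambda>t. norm ((f (\<gamma> t p) - f (\<gamma> 0 p)) /\<^sub>R t - ?D)) \<longlongrightarrow> 0) (at 0)"
          by (rule Lim_transform_eventually[OF lim]) (rule eventually_mono[OF eventually_neq_at_within], rule eq)
        thus ?thesis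
          by (simp add: tendsto_norm_zero_iff LIM_zero_iff)
      qed
      from filterlim_compose[OF this lim_e] show "(\<lambda>n. q n p) \<longlonglongrightarrow> theta_s3 k f p"
        by (simp add: q_def \<gamma>0 divide_inverse)
    qed
  qed
  moreover have "(\<integral>p. q n p \<partial>sigma3) = 0" for n
  proof -
    have d: "distr sigma3 sigma3 (\<gamma> (e n)) = sigma3"
      using e unfolding \<gamma>_def[abs_def] by (intro distr_sigma3_rot_s3) auto
    have "integrable sigma3 (\<lambda>p. f (\<gamma> (e n) p))"
      by (rule integrable_distr[OF meas_\<gamma>]) (simp add: d int_f)
    moreover have "(\<integral>p. f (\<gamma> (e n) p) \<partial>sigma3) = (\<integral>p. f p \<partial>sigma3)"
      using integral_distr[OF meas_\<gamma> meas_f, of "e n"] by (simp add: d)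
    ultimately show ?thesis
      using int_f unfolding q_def by simp
  qed
  ultimately show ?thesis
    using LIMSEQ_unique[OF tendsto_const] by fastforce
qed


section \<open>Quaternion algebra and the derivation \<open>Theta k\<close> on spinors\<close>

lemma qmult_assoc: "qmult (qmult x y) z = qmult x (qmult y z)"
  by (simp add: qmult_def algebra_simps)

lemma qmult_add_left: "qmult (x + y) z = qmult x z + qmult y z"
  and qmult_add_right: "qmult x (y + z) = qmult x y + qmult x z"
  by (simp_all add: qmult_def algebra_simps)

lemma qmult_scaleR_left: "qmult (r *\<^sub>R x) y = r *\<^sub>R qmult x y"
  and qmult_scaleR_right: "qmult x (r *\<^sub>R y) = r *\<^sub>R qmult x y"
  by (simp_all add: qmult_def scaleR_conv_of_real algebra_simps)

lemma qtr_add: "qtr (x + y) = qtr x + qtr y"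
  by (simp add: qtr_def)

lemma qtr_scaleR: "qtr (r *\<^sub>R x) = of_real r * qtr x"
  by (simp add: qtr_def scaleR_conv_of_real algebra_simps)

lemma qtr_qmult_commute: "qtr (qmult x y) = qtr (qmult y x)"
  by (simp add: qtr_def qmult_def algebra_simps)

lemma sp_mult_apply: "sp_mult \<phi> \<psi> p = qmult (\<phi> p) (\<psi> p)"
  by (simp add: sp_mult_def)

text \<open>The cocycle identity evaluates \<open>ck\<close> at products of spinors. Working in this
  larger space, one only has to know that such products are of class C1.\<close>

definition C1H :: "spinor set" where
  "C1H = {\<phi>. C1_s3 (\<lambda>p. fst (\<phi> p)) \<and> C1_s3 (\<lambda>p. snd (\<phi> p))}"

lemma S3H_imp_C1H: "\<phi> \<in> S3H \<Longrightarrow> \<phi> \<in> C1H"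
  by (simp add: S3H_def C1H_def smooth_s3_imp_C1_s3)

lemmas C1_s3_minus = C1_s3_mult[OF C1_s3_const[of "- 1"], simplified]

lemma theta_s3_minus: "C1_s3 f \<Longrightarrow> theta_s3 k (\<lambda>p. - f p) p = - theta_s3 k f p"
  using theta_s3_mult[OF C1_s3_const[of "- 1"], of f k p] by (simp add: theta_s3_const)

lemmas C1_s3_diff = C1_s3_add[OF _ C1_s3_minus, simplified]

lemma theta_s3_diff:
  "C1_s3 f \<Longrightarrow> C1_s3 g \<Longrightarrow> theta_s3 k (\<lambda>p. f p - g p) p = theta_s3 k f p - theta_s3 k g p"
  using theta_s3_add[OF _ C1_s3_minus, of f g k p] by (simp add: theta_s3_minus)

lemma sp_mult_C1H: "\<phi> \<in> C1H \<Longrightarrow> \<psi> \<in> C1H \<Longrightarrow> sp_mult \<phi> \<psi> \<in> C1H"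
  unfolding C1H_def sp_mult_def qmult_def
  by (auto intro!: C1_s3_diff C1_s3_add C1_s3_mult C1_s3_cnj)

text \<open>The quaternion product contains conjugates of the components; the Leibniz rule survives
  because \<open>theta_s3 k\<close> commutes with conjugation.\<close>

lemma Theta_sp_mult:
  assumes "\<phi> \<in> C1H" "\<psi> \<in> C1H"
  shows "Theta k (sp_mult \<phi> \<psi>) p = qmult (Theta k \<phi> p) (\<psi> p) + qmult (\<phi> p) (Theta k \<psi> p)"
  using assms unfolding C1H_def Theta_def sp_mult_def qmult_def
  by (simp add: theta_s3_diff theta_s3_add theta_s3_mult theta_s3_cnj C1_s3_mult C1_s3_cnj field_simps)

lemma Theta_sp_add:
  assumes "\<phi> \<in> C1H" "\<psi> \<in> C1H"
  shows "Theta k (sp_add \<phi> \<psi>) p = Theta k \<phi> p + Theta k \<psi> p"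
  using assms unfolding C1H_def Theta_def sp_add_def by (simp add: theta_s3_add field_simps)

lemma Theta_sp_scale:
  assumes "\<phi> \<in> C1H"
  shows "Theta k (sp_scale r \<phi>) p = r *\<^sub>R Theta k \<phi> p"
  using assms theta_s3_mult[OF C1_s3_const[of "of_real r"], of _ k p]
  unfolding C1H_def Theta_def sp_scale_def
  by (simp add: theta_s3_const scaleR_conv_of_real)

lemma integrable_qtr_sp_mult_Theta:
  assumes "\<phi> \<in> C1H" "\<psi> \<in> C1H"
  shows "integrable sigma3 (\<lambda>p. qtr (sp_mult (Theta k \<phi>) \<psi> p))"
  using assms unfolding C1H_def Theta_def qtr_def sp_mult_def qmult_def fst_conv snd_conv
  by (intro cont_s3_integrable cont_s3_intros cont_s3_C1_s3) auto

text \<open>The integrand is the real part of \<open>theta_s3 k\<close> applied to the first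
  component, and that derivative integrates to 0.\<close>

lemma integral_qtr_Theta:
  assumes "\<phi> \<in> C1H"
  shows "(\<integral>p. qtr (Theta k \<phi> p) \<partial>sigma3) = 0"
proof -
  let ?u = "theta_s3 k (\<lambda>p. fst (\<phi> p))"
  have u: "C1_s3 (\<lambda>p. fst (\<phi> p))"
    using assms by (simp add: C1H_def)
  hence "integrable sigma3 ?u"
    by (intro cont_s3_integrable cont_s3_C1_s3)
  hence "(\<integral>p. ?u p + cnj (?u p) \<partial>sigma3) = 0"
    using integral_theta_s3[OF u, of k] by simp
  moreover have eq: "qtr (Theta k \<phi> p) = (?u p + cnj (?u p)) / 2" for p
    by (simp add: qtr_def Theta_def add_divide_distrib)
  ultimately show ?thesis
    unfolding eq by (simp only: integral_divide_zero div_0)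
qed

section \<open>Reality, skew symmetry, cocycle identity and bilinearity\<close>

lemma ck_in_Reals: "ck k \<phi> \<psi> \<in> \<real>"
proof -
  have "cnj (\<integral>p. qtr (sp_mult (Theta k \<phi>) \<psi> p) \<partial>sigma3) = (\<integral>p. qtr (sp_mult (Theta k \<phi>) \<psi> p) \<partial>sigma3)"
    by (subst Bochner_Integration.integral_cnj[symmetric])
      (simp add: qtr_def add.commute del: Bochner_Integration.integral_cnj)
  thus ?thesis
    unfolding ck_def by (intro Reals_mult Reals_divide) (auto simp: Reals_cnj_iff)
qed

lemma ck_antisym:
  assumes "\<phi> \<in> C1H" "\<psi> \<in> C1H"
  shows "ck k \<phi> \<psi> = - ck k \<psi> \<phi>"
proof -
  have "qtr (sp_mult (Theta k \<phi>) \<psi> p) + qtr (sp_mult (Theta k \<psi>) \<phi> p) = qtr (Theta k (sp_mult \<phi> \<psi>) p)" for p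
    by (simp add: Theta_sp_mult assms qtr_add sp_mult_apply qtr_qmult_commute[of "Theta k \<psi> p"])
  hence "(\<integral>p. qtr (sp_mult (Theta k \<phi>) \<psi> p) \<partial>sigma3) + (\<integral>p. qtr (sp_mult (Theta k \<psi>) \<phi> p) \<partial>sigma3) = 0"
    using integral_qtr_Theta[OF sp_mult_C1H[OF assms], of k]
    by (simp add: integrable_qtr_sp_mult_Theta assms flip: Bochner_Integration.integral_add)
  thus ?thesis
    unfolding ck_def eq_neg_iff_add_eq_0 distrib_left[symmetric] by simp
qed

lemma ck_cocycle:
  assumes "\<phi> \<in> C1H" "\<psi> \<in> C1H" "\<xi> \<in> C1H"
  shows "ck k (sp_mult \<phi> \<psi>) \<xi> + ck k (sp_mult \<psi> \<xi>) \<phi> + ck k (sp_mult \<xi> \<phi>) \<psi> = 0"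
proof -
  let ?T = "\<lambda>\<phi> \<psi> p. qtr (sp_mult (Theta k \<phi>) \<psi> p)"
  have cyc: "qtr (qmult (qmult x y) z) = qtr (qmult (qmult y z) x)" for x y z
    by (simp add: qmult_assoc qtr_qmult_commute[of x])
  \<comment> \<open>The Leibniz rule yields six traces on the left. By cyclicity they agree in
    pairs, each pair having the derivative on the same one of the three spinors; hence the factor
    2.\<close>
  have "?T (sp_mult \<phi> \<psi>) \<xi> p + ?T (sp_mult \<psi> \<xi>) \<phi> p + ?T (sp_mult \<xi> \<phi>) \<psi> p
      = 2 * qtr (Theta k (sp_mult (sp_mult \<phi> \<psi>) \<xi>) p)" for p
    using cyc[of "Theta k \<phi> p" "\<psi> p" "\<xi> p"] cyc[of "\<xi> p" "Theta k \<phi> p" "\<psi> p"]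
      cyc[of "Theta k \<psi> p" "\<xi> p" "\<phi> p"] cyc[of "\<phi> p" "Theta k \<psi> p" "\<xi> p"]
      cyc[of "Theta k \<xi> p" "\<phi> p" "\<psi> p"] cyc[of "\<psi> p" "Theta k \<xi> p" "\<phi> p"]
    by (simp add: Theta_sp_mult sp_mult_C1H assms qtr_add qmult_add_left sp_mult_apply)
  hence "(\<integral>p. ?T (sp_mult \<phi> \<psi>) \<xi> p + ?T (sp_mult \<psi> \<xi>) \<phi> p + ?T (sp_mult \<xi> \<phi>) \<psi> p \<partial>sigma3) = 0"
    using integral_qtr_Theta[OF sp_mult_C1H[OF sp_mult_C1H[OF assms(1,2)] assms(3)], of k] by simp
  thus ?thesis
    unfolding ck_def distrib_left[symmetric]
    by (simp add: integrable_qtr_sp_mult_Theta sp_mult_C1H assms)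
qed

lemma ck_sp_scale:
  assumes "\<phi> \<in> C1H" "\<psi> \<in> C1H"
  shows "ck k \<phi> (sp_scale r \<psi>) = r *\<^sub>R ck k \<phi> \<psi>" "ck k (sp_scale r \<phi>) \<psi> = r *\<^sub>R ck k \<phi> \<psi>"
proof -
  have "sp_mult (Theta k \<phi>) (sp_scale r \<psi>) p = r *\<^sub>R sp_mult (Theta k \<phi>) \<psi> p" for p
    unfolding sp_mult_apply by (simp add: sp_scale_def qmult_scaleR_right)
  moreover have "sp_mult (Theta k (sp_scale r \<phi>)) \<psi> p = r *\<^sub>R sp_mult (Theta k \<phi>) \<psi> p" for p
    unfolding sp_mult_apply by (simp add: Theta_sp_scale assms qmult_scaleR_left)
  ultimately show "ck k \<phi> (sp_scale r \<psi>) = r *\<^sub>R ck k \<phi> \<psi>" "ck k (sp_scale r \<phi>) \<psi> = r *\<^sub>R ck k \<phi> \<psi>"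
    by (simp_all add: ck_def qtr_scaleR scaleR_conv_of_real)
qed

lemma ck_sp_add:
  assumes "\<phi> \<in> C1H" "\<psi> \<in> C1H" "\<xi> \<in> C1H"
  shows "ck k \<phi> (sp_add \<psi> \<xi>) = ck k \<phi> \<psi> + ck k \<phi> \<xi>" "ck k (sp_add \<psi> \<xi>) \<phi> = ck k \<psi> \<phi> + ck k \<xi> \<phi>"
proof -
  have "sp_mult (Theta k \<phi>) (sp_add \<psi> \<xi>) p = sp_mult (Theta k \<phi>) \<psi> p + sp_mult (Theta k \<phi>) \<xi> p" for p
    unfolding sp_mult_apply by (simp add: sp_add_def qmult_add_right)
  moreover have "sp_mult (Theta k (sp_add \<psi> \<xi>)) \<phi> p = sp_mult (Theta k \<psi>) \<phi> p + sp_mult (Theta k \<xi>) \<phi> p" for p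
    unfolding sp_mult_apply by (simp add: Theta_sp_add assms qmult_add_left)
  ultimately show "ck k \<phi> (sp_add \<psi> \<xi>) = ck k \<phi> \<psi> + ck k \<phi> \<xi>" "ck k (sp_add \<psi> \<xi>) \<phi> = ck k \<psi> \<phi> + ck k \<xi> \<phi>"
    using assms by (simp_all add: ck_def qtr_add integrable_qtr_sp_mult_Theta distrib_left)
qed

lemma cochain2_ck: "cochain2 (ck k)"
  by (simp add: cochain2_def cochain1_def ck_sp_scale ck_sp_add S3H_imp_C1H)

section \<open>Linear test functions and non-triviality\<close>

lemma C_diff_on_const: "C_diff_on n U (\<lambda>x. c)"
proof (induction n arbitrary: c)
  case (Suc n)
  show ?case using Suc[of 0] by simp
qed simp

text \<open>The directional derivatives of a linear map are constant functions, so the recursion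
  reduces to \<open>C_diff_on_const\<close> after one step.\<close>

lemma C_diff_on_linear:
  fixes L :: "'a::euclidean_space \<Rightarrow> 'b::real_normed_vector"
  assumes "linear L"
  shows "C_diff_on n U L"
proof -
  have d: "(L has_derivative L) (at x)" for x
    using assms by (simp add: linear_imp_has_derivative)
  hence "frechet_derivative L (at x) = L" for x
    using frechet_derivative_at by metis
  moreover have "continuous_on U L"
    using assms by (simp add: linear_continuous_on linear_conv_bounded_linear)
  ultimately show ?thesis
    using d by (cases n) (auto simp: C_diff_on_const differentiable_def)
qed

lemma smooth_s3_linear:
  assumes "linear L"
  shows "smooth_s3 (\<lambda>p. L (Rep_s3 p))"
  unfolding smooth_s3_def using C_diff_on_linear[OF assms] by (intro exI[of _ UNIV] exI[of _ L]) auto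

lemma linear_complex_spinor_S3H: "linear L \<Longrightarrow> (\<lambda>p. (L (Rep_s3 p), 0)) \<in> S3H"
  using smooth_s3_linear[of L] smooth_s3_linear[of "\<lambda>_. 0"] by (simp add: S3H_def linear_zero)

lemma ck_nontrivial:
  assumes "cochain1 b" "\<forall>\<phi>\<in>S3H. \<forall>\<psi>\<in>S3H. ck k \<phi> \<psi> = b (sp_bracket \<phi> \<psi>)"
  shows False
proof -
  \<comment> \<open>With second component 0 the quaternion product is that of complex functions, so
    these spinors commute and every coboundary vanishes on pairs of them.\<close>
  define \<phi> where "\<phi> L p = (L (Rep_s3 p), 0 :: complex)" for L :: "complex \<times> complex \<Rightarrow> complex" and p
  \<comment> \<open>The partner is the conjugate of the derivative of \<open>L\<close> along the
    field, chosen so that the integrand of \<open>ck\<close> becomes a squared modulus. It is again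
    real-linear, hence smooth.\<close>
  define L' where "L' L x = cnj (L (theta_vec k x))" for L :: "complex \<times> complex \<Rightarrow> complex" and x
  have L': "linear (L' L)" if "linear L" for L
    unfolding L'_def
    by (rule linearI) (simp_all only: linear_add[OF that] linear_scale[OF that]
        linear_add[OF linear_theta_vec] linear_scale[OF linear_theta_vec] complex_cnj_add complex_cnj_scaleR)
  have S3H: "\<phi> L \<in> S3H" if "linear L" for L
    using linear_complex_spinor_S3H[OF that] by (simp add: \<phi>_def[abs_def])
  have zero: "(\<lambda>p. 0) \<in> S3H"
    using S3H[of "\<lambda>_. 0"] by (simp add: \<phi>_def[abs_def] linear_zero zero_prod_def)
  have "b (\<lambda>p. 0) = 0"
  proof -
    have "b (sp_scale 0 (\<lambda>p. 0)) = 0 *\<^sub>R b (\<lambda>p. 0)"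
      using assms(1) zero unfolding cochain1_def by blast
    thus ?thesis by (simp add: sp_scale_def)
  qed
  moreover have "sp_bracket (\<phi> L) (\<phi> M) = (\<lambda>p. 0)" for L M
    by (simp add: fun_eq_iff sp_bracket_def sp_mult_def qmult_def \<phi>_def zero_prod_def mult.commute)
  ultimately have ck0: "ck k (\<phi> L) (\<phi> (L' L)) = 0" if "linear L" for L
    using assms(2) S3H[OF that] S3H[OF L'[OF that]] by simp
  let ?T = "\<lambda>L p. qtr (sp_mult (Theta k (\<phi> L)) (\<phi> (L' L)) p)"
  have lin: "linear (fst :: complex \<times> complex \<Rightarrow> complex)" "linear (snd :: complex \<times> complex \<Rightarrow> complex)"
    by (rule linear_fst linear_snd)+
  \<comment> \<open>The factor 1/2 in \<open>Theta\<close> cancels the 2 coming from the trace,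
    which is twice the real part.\<close>
  have T: "?T L p = of_real ((norm (L (theta_vec k (Rep_s3 p))))\<^sup>2)" if "linear L" for L p
    using theta_s3_linear[OF that, of k p]
    by (simp add: qtr_def sp_mult_def qmult_def Theta_def \<phi>_def L'_def theta_s3_const)
      (simp only: complex_norm_square[symmetric] of_real_power[symmetric])
  \<comment> \<open>Together the two coordinates give the squared length of the whole tangent
    vector, which is 1 everywhere. The integrals therefore add up to the volume of the sphere, while
    each would be 0 for a coboundary.\<close>
  have "?T fst p + ?T snd p = 1" for p
  proof -
    have "?T fst p + ?T snd p = of_real ((norm (theta_vec k (Rep_s3 p)))\<^sup>2)"
      by (simp only: T[OF lin(1)] T[OF lin(2)] norm_prod_def) simp
    thus ?thesis by simp
  qed
  hence "(\<integral>p. ?T fst p + ?T snd p \<partial>sigma3) = of_real (2 * pi\<^sup>2)"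
    by (simp add: measure_sigma3_UNIV scaleR_conv_of_real)
  moreover have "integrable sigma3 (?T L)" if "linear L" for L
    using S3H[OF that] S3H[OF L'[OF that]] by (intro integrable_qtr_sp_mult_Theta S3H_imp_C1H)
  ultimately have "(\<integral>p. ?T fst p \<partial>sigma3) + (\<integral>p. ?T snd p \<partial>sigma3) = of_real (2 * pi\<^sup>2)"
    using lin by simp
  moreover have "(\<integral>p. ?T L p \<partial>sigma3) = 0" if "linear L" for L
    using ck0[OF that] by (simp add: ck_def)
  ultimately show False
    using lin by simp
qed

theorem proposition2p10:
  fixes k :: nat
  assumes "k \<in> {0, 1, 2}"
  shows "cochain2 (ck k) \<and>
    (\<forall>\<phi>\<^sub>1\<in>S3H. \<forall>\<phi>\<^sub>2\<in>S3H. ck k \<phi>\<^sub>1 \<phi>\<^sub>2 \<in> \<real>) \<and>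
    (\<forall>\<phi>\<^sub>1\<in>S3H. \<forall>\<phi>\<^sub>2\<in>S3H. ck k \<phi>\<^sub>1 \<phi>\<^sub>2 = - ck k \<phi>\<^sub>2 \<phi>\<^sub>1) \<and>
    (\<forall>\<phi>\<^sub>1\<in>S3H. \<forall>\<phi>\<^sub>2\<in>S3H. \<forall>\<phi>\<^sub>3\<in>S3H.
       ck k (sp_mult \<phi>\<^sub>1 \<phi>\<^sub>2) \<phi>\<^sub>3 + ck k (sp_mult \<phi>\<^sub>2 \<phi>\<^sub>3) \<phi>\<^sub>1 + ck k (sp_mult \<phi>\<^sub>3 \<phi>\<^sub>1) \<phi>\<^sub>2 = 0) \<and>
    (\<nexists>b. cochain1 b \<and> (\<forall>\<phi>\<^sub>1\<in>S3H. \<forall>\<phi>\<^sub>2\<in>S3H. ck k \<phi>\<^sub>1 \<phi>\<^sub>2 = b (sp_bracket \<phi>\<^sub>1 \<phi>\<^sub>2)))"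
proof (intro conjI ballI notI)
  assume "\<exists>b. cochain1 b \<and> (\<forall>\<phi>\<^sub>1\<in>S3H. \<forall>\<phi>\<^sub>2\<in>S3H. ck k \<phi>\<^sub>1 \<phi>\<^sub>2 = b (sp_bracket \<phi>\<^sub>1 \<phi>\<^sub>2))"
  thus False
    using ck_nontrivial by (elim exE conjE)
qed (intro cochain2_ck ck_in_Reals ck_antisym ck_cocycle S3H_imp_C1H; assumption)+

end
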